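(* For an integer $n\ge 2$ and $c,a\in\mathbb{C}$ let $R_{n,c,a}(z)=z^n+c+\frac{a}{z^n}$, with filled Julia set $K(R_{n,c,a})$ and Julia set $J(R_{n,c,a})=\partial K(R_{n,c,a})$. For any $c\in\mathbb{C}$ and any $a\in\mathbb{C}^*$, $$\lim_{n\to\infty}J(R_{n,c,a})=\lim_{n\to\infty}K(R_{n,c,a})=S^1$$ in the Hausdorff metric.
   Context: $\mathbb{C}^*=\mathbb{C}\setminus\{0\}$; $S^1$ is the unit circle. $R_{n,c,a}$ is regarded as a rational map of the Riemann sphere, with $\infty$ a superattracting fixed point and (for $a\ne 0$) $0\mapsto\infty$. $K(R_{n,c,a})$ is the set of points with bounded orbits under $R_{n,c,a}$ (in particular the orbit never reaches $\infty$). The Hausdorff metric is $d_{\mathcal{H}}(A,B)=\max\{\sup_{a\in A}\inf_{b\in B}d(a,b),\ \sup_{b\in B}\inf_{a\in A}d(a,b)\}$, and $\lim_{n\to\infty}S_n=S$ means that for all $\epsilon>0$ there is $N$ with $d_{\mathcal{H}}(S_n,S)<\epsilon$ for all $n\ge N$. *)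

theory Defs
  imports "HOL-Analysis.Analysis"
begin

(* The Riemann sphere is rendered as complex option, with None as the point at infinity.
   The value at 0 is given separately because division by zero is 0 in HOL; it is infinity
   only when a is nonzero, since otherwise the map is the polynomial z^n + c. *)
definition R :: "nat \<Rightarrow> complex \<Rightarrow> complex \<Rightarrow> complex option \<Rightarrow> complex option" where
  "R n c a p = (case p of
      None \<Rightarrow> None
    | Some z \<Rightarrow> if z = 0 \<and> a \<noteq> 0 then None else Some (z ^ n + c + a / z ^ n))"

definition filled_julia :: "nat \<Rightarrow> complex \<Rightarrow> complex \<Rightarrow> complex set" where
  "filled_julia n c a =
     {z. \<exists>B::real. \<forall>k::nat. \<exists>w. (R n c a ^^ k) (Some z) = Some w \<and> cmod w \<le> B}"

definition julia :: "nat \<Rightarrow> complex \<Rightarrow> complex \<Rightarrow> complex set" where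
  "julia n c a = frontier (filled_julia n c a)"

(* Valued in ennreal so that the suprema and infima are the true ones for all sets: the
   distance of an empty or unbounded set to a nonempty bounded set is infinite. *)
definition hausdorff_dist :: "'a::metric_space set \<Rightarrow> 'a set \<Rightarrow> ennreal" where
  "hausdorff_dist A B =
     max (SUP a\<in>A. INF b\<in>B. ennreal (dist a b)) (SUP b\<in>B. INF a\<in>A. ennreal (dist a b))"

definition hausdorff_lim :: "(nat \<Rightarrow> 'a::metric_space set) \<Rightarrow> 'a set \<Rightarrow> bool" where
  "hausdorff_lim S L \<longleftrightarrow>
     (\<forall>\<epsilon>::real. \<epsilon> > 0 \<longrightarrow> (\<exists>N. \<forall>n\<ge>N. hausdorff_dist (S n) L < ennreal \<epsilon>))"

end

theory Submission
  imports Defs "HOL-Computational_Algebra.Fundamental_Theorem_Algebra"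
begin

text \<open>
  Write \<open>K\<close> for the filled Julia set of \<open>R(z) = z^n + c + a / z^n\<close>. Two facts about large \<open>n\<close>
  force the limit to be the unit circle.

  First, \<open>K\<close> lies in a thin annulus around the circle. Outside a disc of radius \<open>\<rho> > 1\<close> the
  term \<open>z^n\<close> dominates and every orbit grows geometrically (\<open>filled_julia_cmod_le\<close>). On a disc of
  radius \<open>r < 1\<close> the term \<open>a / z^n\<close> dominates and one step of the map already lands in the escaping
  region (\<open>filled_julia_cmod_ge\<close>).

  Second, \<open>K\<close> comes close to every point \<open>s\<close> of the circle. By the fundamental theorem of algebra
  \<open>R\<close> has a fixed point \<open>u\<close>, and \<open>u\<close> lies in \<open>K\<close>; since \<open>K\<close> is backward invariant, it is enough
  to find a preimage of \<open>u\<close> near \<open>s\<close>. The map factors as \<open>z \<mapsto> w = z^n\<close> followed by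
  \<open>w \<mapsto> w + c + a / w\<close>. The second factor is a quadratic equation for \<open>w\<close>, whose roots stay
  in a compact subset of the punctured plane that does not depend on \<open>n\<close>
  (\<open>joukowski_preimage\<close>). The \<open>n\<close>-th roots of such a \<open>w\<close> have modulus close to 1 and arguments
  spaced by \<open>2 \<pi> / n\<close>, so one of them is close to \<open>s\<close> (\<open>exists_nth_root_near_unit\<close>).

  The Julia set is the frontier of \<open>K\<close>. It inherits the annulus bound because the annulus is
  closed, and the density because a ball around \<open>s\<close> is connected and contains points both of \<open>K\<close>
  and, outside the annulus, of its complement.
\<close>

section \<open>Hausdorff distance\<close>

lemma hausdorff_dist_leI:
  assumes "\<And>x. x \<in> A \<Longrightarrow> \<exists>y\<in>B. dist x y \<le> e"
    and "\<And>y. y \<in> B \<Longrightarrow> \<exists>x\<in>A. dist x y \<le> e"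
  shows "hausdorff_dist A B \<le> ennreal e"
  unfolding hausdorff_dist_def
proof (intro max.boundedI SUP_least)
  fix x assume "x \<in> A"
  then show "(INF y\<in>B. ennreal (dist x y)) \<le> ennreal e"
    using assms(1) by (meson INF_lower2 ennreal_leI)
next
  fix y assume "y \<in> B"
  then show "(INF x\<in>A. ennreal (dist x y)) \<le> ennreal e"
    using assms(2) by (meson INF_lower2 ennreal_leI)
qed

section \<open>Invariance of the filled Julia set\<close>

lemma filled_julia_forward:
  assumes "z \<in> filled_julia n c a" and "a \<noteq> 0"
  shows "z \<noteq> 0" and "z ^ n + c + a / z ^ n \<in> filled_julia n c a"
proof -
  obtain B where B: "\<And>k. \<exists>w. (R n c a ^^ k) (Some z) = Some w \<and> cmod w \<le> B"
    using assms(1) unfolding filled_julia_def by blast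
  show "z \<noteq> 0"
    using B[of 1] assms(2) by (auto simp: R_def)
  then have "R n c a (Some z) = Some (z ^ n + c + a / z ^ n)"
    by (simp add: R_def)
  then have "(R n c a ^^ k) (Some (z ^ n + c + a / z ^ n)) = (R n c a ^^ Suc k) (Some z)" for k
    by (simp add: funpow_swap1)
  then show "z ^ n + c + a / z ^ n \<in> filled_julia n c a"
    unfolding filled_julia_def using B by (auto simp del: funpow.simps)
qed

lemma filled_julia_backward:
  assumes "z ^ n + c + a / z ^ n \<in> filled_julia n c a" and "z \<noteq> 0"
  shows "z \<in> filled_julia n c a"
proof -
  let ?w = "z ^ n + c + a / z ^ n"
  obtain B where B: "\<And>k. \<exists>w. (R n c a ^^ k) (Some ?w) = Some w \<and> cmod w \<le> B"
    using assms(1) unfolding filled_julia_def by blast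
  have step: "(R n c a ^^ Suc k) (Some z) = (R n c a ^^ k) (Some ?w)" for k
    using assms(2) by (simp add: R_def funpow_Suc_right del: funpow.simps)
  have "\<exists>w. (R n c a ^^ k) (Some z) = Some w \<and> cmod w \<le> max B (cmod z)" for k
  proof (cases k)
    case (Suc j)
    then show ?thesis
      using B[of j] unfolding Suc step by (auto simp: le_max_iff_disj)
  qed simp
  then show ?thesis
    unfolding filled_julia_def by blast
qed

lemma fixed_point_in_filled_julia:
  assumes "z ^ n + c + a / z ^ n = z" and "z \<noteq> 0"
  shows "z \<in> filled_julia n c a"
proof -
  have "(R n c a ^^ k) (Some z) = Some z" for k
    by (induction k) (use assms in \<open>auto simp: R_def\<close>)
  then show ?thesis
    unfolding filled_julia_def by auto
qed

text \<open>
  The equation \<open>R(z) = z\<close>, multiplied by \<open>z^n\<close>, is a polynomial equation of degree \<open>2 n\<close>, so a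
  root exists; its constant term is \<open>a\<close>, so the root is not 0 and the denominator can be restored.
\<close>
lemma filled_julia_nonempty:
  assumes "a \<noteq> 0" and "n \<ge> 2"
  shows "filled_julia n c a \<noteq> {}"
proof -
  define p where "p = monom 1 (2 * n) + monom c n - monom 1 (Suc n) + [:a:]"
  have eval: "poly p z = z ^ n * z ^ n + c * z ^ n - z * z ^ n + a" for z
    by (simp add: p_def poly_monom mult_2 power_add)
  have "coeff p (2 * n) = 1"
    using assms(2) by (auto simp: p_def coeff_pCons split: nat.splits)
  then have "degree p \<noteq> 0"
    using assms(2) coeff_eq_0[of p "2 * n"] by (cases "degree p = 0") auto
  then have "\<not> constant (poly p)"
    by (simp add: constant_degree)
  then obtain z where "poly p z = 0"
    using fundamental_theorem_of_algebra by blast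
  then have root: "z ^ n * z ^ n + c * z ^ n - z * z ^ n + a = 0"
    by (simp add: eval)
  then have "z \<noteq> 0"
    using assms by (auto simp: power_0_left)
  moreover from this root have "z ^ n + c + a / z ^ n = z"
    by (simp add: field_simps)
  ultimately show ?thesis
    using fixed_point_in_filled_julia by blast
qed

section \<open>Confinement to a thin annulus\<close>

text \<open>
  Where \<open>cmod z \<ge> \<rho>\<close>, the hypothesis on \<open>\<rho> ^ n\<close> makes the leading term large enough to absorb
  \<open>c\<close> and \<open>a / z^(n+1)\<close> and still multiply the modulus by \<open>\<rho>\<close>, so orbits starting there are
  unbounded. The exponent is \<open>Suc n\<close> because one power of \<open>z\<close> is kept as the factor that grows.
\<close>
lemma filled_julia_cmod_le:
  assumes "\<rho> > 1" and n: "\<rho> + cmod c + cmod a \<le> \<rho> ^ n"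
    and z: "z \<in> filled_julia (Suc n) c a"
  shows "cmod z \<le> \<rho>"
proof (rule ccontr)
  assume "\<not> cmod z \<le> \<rho>"
  then have big: "\<rho> \<le> cmod z" by simp
  have expand: "\<rho> * cmod w \<le> cmod (w ^ Suc n + c + a / w ^ Suc n)" if "\<rho> \<le> cmod w" for w
  proof -
    have w1: "1 \<le> cmod w" using that assms(1) by simp
    have "\<rho> * cmod w + cmod c + cmod a \<le> (\<rho> + cmod c + cmod a) * cmod w"
      using mult_left_mono[OF w1, of "cmod c + cmod a"] by (simp add: algebra_simps)
    also have "\<dots> \<le> cmod w ^ n * cmod w"
      using n power_mono[OF that, of n] assms(1) by (intro mult_right_mono) auto
    also have "\<dots> = cmod (w ^ Suc n)"
      by (simp add: norm_mult norm_power)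
    finally have 1: "\<rho> * cmod w + cmod c + cmod a \<le> cmod (w ^ Suc n)" .
    have "1 \<le> cmod w ^ Suc n" using w1 by (rule one_le_power)
    then have "cmod (a / w ^ Suc n) \<le> cmod a"
      using mult_left_mono[of 1 "cmod w ^ Suc n" "cmod a"]
      by (simp add: norm_divide norm_power divide_le_eq del: power_Suc)
    moreover have "cmod (w ^ Suc n) \<le> cmod (w ^ Suc n + c + a / w ^ Suc n) + cmod c + cmod (a / w ^ Suc n)"
      using norm_triangle_ineq4[of "w ^ Suc n + c + a / w ^ Suc n" "c + a / w ^ Suc n"]
        norm_triangle_ineq[of c "a / w ^ Suc n"] by (simp add: algebra_simps)
    ultimately show ?thesis using 1 by linarith
  qed
  obtain B where B: "\<And>k. \<exists>w. (R (Suc n) c a ^^ k) (Some z) = Some w \<and> cmod w \<le> B"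
    using z unfolding filled_julia_def by blast
  have orbit: "\<exists>w. (R (Suc n) c a ^^ k) (Some z) = Some w \<and> \<rho> ^ Suc k \<le> cmod w" for k
  proof (induction k)
    case 0
    then show ?case using big by simp
  next
    case (Suc k)
    then obtain w where w: "(R (Suc n) c a ^^ k) (Some z) = Some w" "\<rho> ^ Suc k \<le> cmod w"
      by blast
    have "\<rho> * 1 \<le> \<rho> * \<rho> ^ k"
      using assms(1) by (intro mult_left_mono one_le_power) auto
    then have "\<rho> \<le> cmod w" using w(2) by simp
    then have "w \<noteq> 0" using assms(1) by auto
    have "\<rho> ^ Suc (Suc k) \<le> \<rho> * cmod w"
      using mult_left_mono[OF w(2), of \<rho>] assms(1) by simp
    have "(R (Suc n) c a ^^ Suc k) (Some z) = R (Suc n) c a (Some w)"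
      using w(1) by simp
    also have "\<dots> = Some (w ^ Suc n + c + a / w ^ Suc n)"
      using \<open>w \<noteq> 0\<close> by (simp add: R_def)
    finally show ?case
      using expand[OF \<open>\<rho> \<le> cmod w\<close>] \<open>\<rho> ^ Suc (Suc k) \<le> \<rho> * cmod w\<close>
      by (auto simp del: funpow.simps power_Suc)
  qed
  obtain k where "B < \<rho> ^ k"
    using real_arch_pow[OF assms(1)] by blast
  also have "\<dots> \<le> \<rho> ^ Suc k"
    using assms(1) by (intro power_increasing) auto
  finally show False
    using B[of k] orbit[of k] by force
qed

text \<open>
  The image of a point of the filled Julia set is again in it, hence of modulus at most \<open>\<rho>\<close>.
  Solving for the pole term shows that \<open>z^n\<close> cannot be much smaller than \<open>a\<close>.
\<close>
lemma filled_julia_cmod_ge: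
  assumes "\<And>w. w \<in> filled_julia n c a \<Longrightarrow> cmod w \<le> \<rho>"
    and "0 \<le> r" "r \<le> 1" and r: "r ^ n * (\<rho> + 1 + cmod c) < cmod a"
    and z: "z \<in> filled_julia n c a" and "a \<noteq> 0"
  shows "r \<le> cmod z"
proof (rule ccontr)
  assume "\<not> r \<le> cmod z"
  then have zr: "cmod z \<le> r" "cmod z \<le> 1" using assms(3) by auto
  let ?w = "z ^ n + c + a / z ^ n"
  have "z \<noteq> 0" and w: "cmod ?w \<le> \<rho>"
    using filled_julia_forward[OF z \<open>a \<noteq> 0\<close>] assms(1) by auto
  have "a = z ^ n * (?w - z ^ n - c)"
    using \<open>z \<noteq> 0\<close> by (simp add: field_simps)
  then have "cmod a = cmod z ^ n * cmod (?w - z ^ n - c)"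
    by (metis norm_mult norm_power)
  also have "\<dots> \<le> r ^ n * (\<rho> + 1 + cmod c)"
  proof (intro mult_mono power_mono)
    have "cmod (z ^ n) \<le> 1" using zr(2) by (simp add: norm_power power_le_one)
    then show "cmod (?w - z ^ n - c) \<le> \<rho> + 1 + cmod c"
      using w norm_triangle_ineq4[of ?w "z ^ n"] norm_triangle_ineq4[of "?w - z ^ n" c] by linarith
  qed (use zr assms(2) in auto)
  finally show False using r by simp
qed

lemma eventually_filled_julia_annulus:
  assumes "a \<noteq> 0" and "0 < \<epsilon>"
  shows "\<forall>\<^sub>F n in sequentially. \<forall>z\<in>filled_julia n c a. \<bar>cmod z - 1\<bar> \<le> \<epsilon>"
proof -
  \<comment> \<open>The maximum keeps the inner radius nonnegative when \<open>\<epsilon> > 1\<close>.\<close>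
  define r where "r = max 0 (1 - \<epsilon>)"
  have r: "0 \<le> r" "r < 1" "1 - \<epsilon> \<le> r" using assms(2) by (auto simp: r_def)
  obtain N where N: "1 + \<epsilon> + cmod c + cmod a < (1 + \<epsilon>) ^ N"
    using real_arch_pow[of "1 + \<epsilon>"] assms(2) by auto
  have "(\<lambda>n. r ^ n * (1 + \<epsilon> + 1 + cmod c)) \<longlonglongrightarrow> 0 * (1 + \<epsilon> + 1 + cmod c)"
    using r by (intro tendsto_mult tendsto_const LIMSEQ_realpow_zero)
  then have inner: "\<forall>\<^sub>F n in sequentially. r ^ n * (1 + \<epsilon> + 1 + cmod c) < cmod a"
    by (rule order_tendstoD) (use assms in simp)
  show ?thesis
    using inner eventually_gt_at_top[of N]
  proof eventually_elim
    case (elim n)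
    then obtain m where m: "n = Suc m" "N \<le> m" by (cases n) auto
    have "(1 + \<epsilon>) ^ N \<le> (1 + \<epsilon>) ^ m"
      using m(2) assms(2) by (intro power_increasing) auto
    then have "1 + \<epsilon> + cmod c + cmod a \<le> (1 + \<epsilon>) ^ m"
      using N by linarith
    then have outer: "cmod w \<le> 1 + \<epsilon>" if "w \<in> filled_julia n c a" for w
      using filled_julia_cmod_le[of "1 + \<epsilon>" c a m w] that assms m(1) by simp
    show ?case
      using filled_julia_cmod_ge[OF outer r(1) _ elim(1)] outer r assms(1) by fastforce
  qed
qed

section \<open>Preimages accumulate on the whole circle\<close>

text \<open>
  Consecutive \<open>n\<close>-th roots of \<open>w\<close> differ in argument by \<open>2 \<pi> / n\<close>, so one of them has an argument
  within that distance of the argument of \<open>s\<close>; the rest of the error is radial.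
\<close>
lemma exists_nth_root_near_unit:
  assumes "cmod s = 1" and "n > 0"
  shows "\<exists>z. z ^ n = w \<and> dist z s \<le> \<bar>root n (cmod w) - 1\<bar> + 2 * pi / n"
proof -
  obtain \<theta> where s: "s = cis \<theta>"
    using assms(1) by (metis cis_Arg norm_zero sgn_eq zero_neq_one div_by_1 of_real_1)
  define \<phi> where "\<phi> = Arg w"
  \<comment> \<open>The arguments \<open>(\<phi> + 2 \<pi> k) / n\<close> are those of the roots; this \<open>k\<close> gives the last one not
    exceeding \<open>\<theta>\<close>.\<close>
  define k where "k = \<lfloor>(n * \<theta> - \<phi>) / (2 * pi)\<rfloor>"
  define \<psi> where "\<psi> = (\<phi> + 2 * pi * k) / n"
  define z where "z = of_real (root n (cmod w)) * cis \<psi>"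
  have n\<psi>: "real n * \<psi> = \<phi> + 2 * pi * k" using assms(2) by (simp add: \<psi>_def)
  have "z ^ n = of_real (cmod w) * cis (\<phi> + 2 * pi * k)"
  proof -
    have "z ^ n = of_real (root n (cmod w) ^ n) * cis \<psi> ^ n"
      by (simp add: z_def power_mult_distrib)
    also have "root n (cmod w) ^ n = cmod w"
      using assms(2) by (simp add: real_root_pow_pos2)
    finally show ?thesis
      by (simp only: Complex.DeMoivre n\<psi>)
  qed
  also have "cis (\<phi> + 2 * pi * k) = cis \<phi>"
    by (simp add: cis_mult[symmetric] cis_multiple_2pi)
  also have "of_real (cmod w) * cis \<phi> = w"
    by (metis \<phi>_def rcis_cmod_Arg rcis_def)
  finally have "z ^ n = w" .
  have "0 \<le> (n * \<theta> - \<phi>) - 2 * pi * k" "(n * \<theta> - \<phi>) - 2 * pi * k \<le> 2 * pi"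
  proof -
    have "k \<le> (n * \<theta> - \<phi>) / (2 * pi)" "(n * \<theta> - \<phi>) / (2 * pi) \<le> k + 1"
      unfolding k_def by linarith+
    then show "0 \<le> (n * \<theta> - \<phi>) - 2 * pi * k" "(n * \<theta> - \<phi>) - 2 * pi * k \<le> 2 * pi"
      by (simp_all add: field_simps)
  qed
  then have "\<bar>n * (\<psi> - \<theta>)\<bar> \<le> 2 * pi"
    using n\<psi> by (simp add: algebra_simps abs_le_iff)
  then have "\<bar>\<psi> - \<theta>\<bar> \<le> 2 * pi / n"
    using assms(2) by (simp add: abs_mult pos_le_divide_eq mult.commute)
  moreover have "cmod (cis \<psi> - cis \<theta>) \<le> \<bar>\<psi> - \<theta>\<bar>"
  proof -
    have "cis \<psi> - cis \<theta> = cis \<theta> * (cis (\<psi> - \<theta>) - 1)"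
      by (simp add: algebra_simps cis_mult)
    then have "cmod (cis \<psi> - cis \<theta>) = 2 * \<bar>sin ((\<psi> - \<theta>) / 2)\<bar>"
      using dist_exp_i_1[of "\<psi> - \<theta>"] by (simp add: norm_mult cis_conv_exp)
    then show ?thesis
      using abs_sin_x_le_abs_x[of "(\<psi> - \<theta>) / 2"] by simp
  qed
  moreover have "cmod (z - cis \<psi>) = \<bar>root n (cmod w) - 1\<bar>"
  proof -
    have "z - cis \<psi> = of_real (root n (cmod w) - 1) * cis \<psi>"
      by (simp add: z_def algebra_simps)
    then show ?thesis by (simp add: norm_mult del: of_real_diff)
  qed
  ultimately have "dist z s \<le> \<bar>root n (cmod w) - 1\<bar> + 2 * pi / n"
    using norm_triangle_ineq[of "z - cis \<psi>" "cis \<psi> - cis \<theta>"] by (simp add: dist_norm s)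
  with \<open>z ^ n = w\<close> show ?thesis by blast
qed

text \<open>
  The equation is \<open>w^2 + (c - u) w + a = 0\<close>. All of its roots are bounded by \<open>M\<close>, and the product
  of the two roots is \<open>a\<close>; so the upper bound applied to \<open>a / w\<close> is the lower bound for \<open>w\<close>.
\<close>
lemma joukowski_preimage:
  fixes a c u :: complex
  assumes "a \<noteq> 0"
  defines "M \<equiv> 1 + cmod c + cmod u + cmod a"
  shows "\<exists>w. w \<noteq> 0 \<and> w + c + a / w = u \<and> cmod a / M \<le> cmod w \<and> cmod w \<le> M"
proof -
  have bound: "cmod x \<le> M" if "x * x = (u - c) * x - a" for x
  proof (cases "cmod x \<le> 1")
    case False
    have "cmod x * cmod x = cmod ((u - c) * x - a)"
      using that by (simp flip: norm_mult)
    also have "\<dots> \<le> cmod (u - c) * cmod x + cmod a"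
      by (metis norm_mult norm_triangle_ineq4)
    also have "\<dots> \<le> cmod (u - c) * cmod x + cmod a * cmod x"
      using False mult_left_mono[of 1 "cmod x" "cmod a"] by simp
    finally have "cmod x * cmod x \<le> (cmod (u - c) + cmod a) * cmod x"
      by (simp add: algebra_simps)
    then have "cmod x \<le> cmod (u - c) + cmod a"
      using False by (subst (asm) mult_le_cancel_right_pos) auto
    then show ?thesis
      using norm_triangle_ineq4[of u c] by (simp add: M_def)
  qed (auto simp: M_def intro: order_trans)
  define d where "d = csqrt ((u - c)\<^sup>2 - 4 * a)"
  define w where "w = (u - c + d) / 2"
  have "d * d = (u - c)\<^sup>2 - 4 * a"
    by (simp add: d_def flip: power2_eq_square)
  moreover have "d = 2 * w - (u - c)"
    by (simp add: w_def field_simps)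
  ultimately have "4 * (w * w) = 4 * ((u - c) * w - a)"
    by (simp add: algebra_simps power2_eq_square)
  then have root: "w * w = (u - c) * w - a"
    by (simp only: mult_cancel_left) simp
  then have "w \<noteq> 0" using assms(1) by auto
  have "(a / w) * (a / w) = (u - c) * (a / w) - a"
  proof -
    have "a * a = a * ((u - c) * w - w * w)" using root by simp
    then show ?thesis using \<open>w \<noteq> 0\<close> by (simp add: field_simps)
  qed
  then have "cmod a / cmod w \<le> M"
    using bound by (metis norm_divide)
  moreover have "M > 0" by (simp add: M_def add_pos_nonneg)
  ultimately have "cmod a / M \<le> cmod w"
    using \<open>w \<noteq> 0\<close> by (simp add: field_simps)
  moreover have "w + c + a / w = u"
    using root \<open>w \<noteq> 0\<close> by (simp add: field_simps)
  ultimately show ?thesis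
    using bound[OF root] \<open>w \<noteq> 0\<close> by blast
qed

text \<open>
  The point \<open>u\<close> whose preimages are taken depends on \<open>n\<close>, but the annulus bound keeps it in a fixed
  disc. The bounds on \<open>w\<close> are therefore uniform in \<open>n\<close>, and the \<open>n\<close>-th roots of both bounds tend
  to 1.
\<close>
lemma eventually_filled_julia_near_circle:
  assumes "a \<noteq> 0" and "0 < \<epsilon>"
  shows "\<forall>\<^sub>F n in sequentially. \<forall>s\<in>sphere 0 1. \<exists>z\<in>filled_julia n c a. dist z s < \<epsilon>"
proof -
  \<comment> \<open>The bound of \<open>joukowski_preimage\<close> for \<open>u\<close> of modulus at most 2.\<close>
  define M where "M = 3 + cmod c + cmod a"
  have "M > 0" by (simp add: M_def add_pos_nonneg)
  have "(\<lambda>n. \<bar>root n (cmod a / M) - 1\<bar> + \<bar>root n M - 1\<bar> + 2 * pi / n) \<longlonglongrightarrow> \<bar>1 - 1\<bar> + \<bar>1 - 1\<bar> + 0"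
    using \<open>M > 0\<close> assms(1) by (intro tendsto_intros LIMSEQ_root_const lim_const_over_n) auto
  then have small: "\<forall>\<^sub>F n in sequentially. \<bar>root n (cmod a / M) - 1\<bar> + \<bar>root n M - 1\<bar> + 2 * pi / n < \<epsilon>"
    by (rule order_tendstoD) (use assms in simp)
  show ?thesis
    using small eventually_ge_at_top[of 2] eventually_filled_julia_annulus[OF assms(1) zero_less_one, of c]
  proof eventually_elim
    case (elim n)
    obtain u where u: "u \<in> filled_julia n c a"
      using filled_julia_nonempty[OF assms(1) elim(2)] by blast
    have u2: "cmod u \<le> 2" using elim(3) u by fastforce
    obtain w where w: "w \<noteq> 0" "w + c + a / w = u"
      "cmod a / (1 + cmod c + cmod u + cmod a) \<le> cmod w" "cmod w \<le> 1 + cmod c + cmod u + cmod a"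
      using joukowski_preimage[OF assms(1)] by blast
    have upper: "cmod w \<le> M" using w(4) u2 by (simp add: M_def)
    have "cmod a / M \<le> cmod a / (1 + cmod c + cmod u + cmod a)"
      using u2 by (intro divide_left_mono mult_pos_pos) (auto simp: M_def add_pos_nonneg)
    then have lower: "cmod a / M \<le> cmod w" using w(3) by simp
    have "root n (cmod a / M) \<le> root n (cmod w)" "root n (cmod w) \<le> root n M"
      using upper lower elim(2) by (auto intro: real_root_le_mono)
    then have close: "\<bar>root n (cmod w) - 1\<bar> + 2 * pi / n < \<epsilon>"
      using elim(1) by linarith
    show ?case
    proof
      fix s :: complex assume "s \<in> sphere 0 1"
      then obtain z where z: "z ^ n = w" "dist z s \<le> \<bar>root n (cmod w) - 1\<bar> + 2 * pi / n"
        using exists_nth_root_near_unit[of s n w] elim(2) by auto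
      have "z \<noteq> 0" using z(1) w(1) elim(2) by (auto simp: power_0_left)
      then have "z \<in> filled_julia n c a"
        using filled_julia_backward[of z n c a] z(1) w(2) u by simp
      then show "\<exists>z\<in>filled_julia n c a. dist z s < \<epsilon>"
        using z(2) close by force
    qed
  qed
qed

text \<open>
  A ball around a point of the circle meets the filled Julia set and also sticks out of the annulus
  that contains it, so by connectedness it meets the frontier.
\<close>
lemma eventually_julia_near_circle:
  assumes "a \<noteq> 0" and "0 < \<epsilon>"
  shows "\<forall>\<^sub>F n in sequentially. \<forall>s\<in>sphere 0 1. \<exists>z\<in>julia n c a. dist z s < \<epsilon>"
proof -
  have quarter: "0 < \<epsilon> / 4" using assms(2) by simp
  show ?thesis
    using eventually_filled_julia_near_circle[OF assms, of c]
      eventually_filled_julia_annulus[OF assms(1) quarter, of c]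
  proof eventually_elim
    case (elim n)
    show ?case
    proof
      fix s :: complex assume s: "s \<in> sphere 0 1"
      \<comment> \<open>A point of the ball that lies outside the annulus of half-width \<open>\<epsilon> / 4\<close>.\<close>
      let ?x = "of_real (1 + \<epsilon> / 2) * s"
      have "?x - s = of_real (\<epsilon> / 2) * s" by (simp add: algebra_simps)
      then have "cmod (?x - s) = \<bar>\<epsilon> / 2\<bar> * cmod s"
        by (metis norm_mult norm_of_real)
      then have "dist ?x s = \<epsilon> / 2"
        using s assms(2) by (simp add: dist_norm)
      then have in_ball: "?x \<in> ball s \<epsilon>"
        using assms(2) \<open>dist ?x s = \<epsilon> / 2\<close> by (simp only: mem_ball dist_commute[of s])
      have "cmod ?x = 1 + \<epsilon> / 2"
        using s assms(2) by (simp only: norm_mult norm_of_real) simp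
      then have "?x \<notin> filled_julia n c a"
        using elim(2) assms(2) by force
      with in_ball have "ball s \<epsilon> - filled_julia n c a \<noteq> {}" by blast
      moreover have "ball s \<epsilon> \<inter> filled_julia n c a \<noteq> {}"
        using elim(1) s by (force simp: dist_commute)
      ultimately have "ball s \<epsilon> \<inter> julia n c a \<noteq> {}"
        unfolding julia_def by (intro connected_Int_frontier) auto
      then show "\<exists>z\<in>julia n c a. dist z s < \<epsilon>"
        by (auto simp: dist_commute)
    qed
  qed
qed

lemma eventually_julia_annulus:
  assumes "a \<noteq> 0" and "0 < \<epsilon>"
  shows "\<forall>\<^sub>F n in sequentially. \<forall>z\<in>julia n c a. \<bar>cmod z - 1\<bar> \<le> \<epsilon>"
  using eventually_filled_julia_annulus[OF assms, of c]
proof eventually_elim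
  case (elim n)
  have "closed {z. \<bar>cmod z - 1\<bar> \<le> \<epsilon>}"
    by (intro closed_Collect_le continuous_intros)
  then have "closure (filled_julia n c a) \<subseteq> {z. \<bar>cmod z - 1\<bar> \<le> \<epsilon>}"
    using elim by (intro closure_minimal) auto
  then show ?case
    unfolding julia_def frontier_def by blast
qed

section \<open>Convergence\<close>

lemma hausdorff_lim_unit_circleI:
  fixes S :: "nat \<Rightarrow> complex set"
  assumes annulus: "\<And>\<epsilon>. 0 < \<epsilon> \<Longrightarrow> \<forall>\<^sub>F n in sequentially. \<forall>z\<in>S n. \<bar>cmod z - 1\<bar> \<le> \<epsilon>"
    and near: "\<And>\<epsilon>. 0 < \<epsilon> \<Longrightarrow> \<forall>\<^sub>F n in sequentially. \<forall>s\<in>sphere 0 1. \<exists>z\<in>S n. dist z s < \<epsilon>"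
  shows "hausdorff_lim S (sphere 0 1)"
  unfolding hausdorff_lim_def
proof (intro allI impI)
  fix \<epsilon> :: real assume "0 < \<epsilon>"
  then have half: "0 < \<epsilon> / 2" by simp
  have radial: "\<exists>s\<in>sphere 0 1. dist z s \<le> \<bar>cmod z - 1\<bar>" for z :: complex
  proof
    \<comment> \<open>The centre has distance 1 from every point of the circle, so any choice works there.\<close>
    let ?s = "if z = 0 then 1 else sgn z"
    show "?s \<in> sphere 0 1" by (simp add: norm_sgn)
    have "of_real (cmod z) * sgn z = z"
      by (simp add: sgn_eq)
    then have "z - sgn z = of_real (cmod z - 1) * sgn z"
      by (simp add: left_diff_distrib)
    then have "cmod (z - sgn z) = \<bar>cmod z - 1\<bar> * cmod (sgn z)"
      by (metis norm_mult norm_of_real)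
    then show "dist z ?s \<le> \<bar>cmod z - 1\<bar>"
      by (simp add: dist_norm norm_sgn)
  qed
  have "\<forall>\<^sub>F n in sequentially. hausdorff_dist (S n) (sphere 0 1) < ennreal \<epsilon>"
    using annulus[OF half] near[OF half]
  proof eventually_elim
    case (elim n)
    have "hausdorff_dist (S n) (sphere 0 1) \<le> ennreal (\<epsilon> / 2)"
    proof (rule hausdorff_dist_leI)
      show "\<exists>s\<in>sphere 0 1. dist z s \<le> \<epsilon> / 2" if "z \<in> S n" for z
        using radial[of z] elim(1) that by force
      show "\<exists>z\<in>S n. dist z s \<le> \<epsilon> / 2" if "s \<in> sphere 0 1" for s
        using elim(2) that less_imp_le by blast
    qed
    also have "\<dots> < ennreal \<epsilon>"
      using \<open>0 < \<epsilon>\<close> by (intro ennreal_lessI) auto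
    finally show ?case .
  qed
  then show "\<exists>N. \<forall>n\<ge>N. hausdorff_dist (S n) (sphere 0 1) < ennreal \<epsilon>"
    by (simp add: eventually_sequentially)
qed

theorem theorem1p4:
  fixes c a :: complex
  assumes "a \<noteq> 0"
  shows "hausdorff_lim (\<lambda>n. julia n c a) (sphere 0 1) \<and>
         hausdorff_lim (\<lambda>n. filled_julia n c a) (sphere 0 1)"
  using assms eventually_julia_annulus eventually_julia_near_circle
    eventually_filled_julia_annulus eventually_filled_julia_near_circle
  by (intro conjI hausdorff_lim_unit_circleI) auto

end
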